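(* For all sufficiently large $n$, the acyclic polynomial $A\left(K_{1,n-1}[K_2],x\right)$ has a root with a positive real part.
   Context: Graphs are finite, undirected and simple. The acyclic polynomial of a graph $G$ is $A(G,x)=\sum_{i\ge 0} a_i x^i$, where $a_i=|\{S\subseteq V(G): |S|=i \text{ and } G[S] \text{ is acyclic}\}|$ and $G[S]$ is the subgraph of $G$ induced by $S$ (acyclic means containing no cycle; the empty set is acyclic). $G[H]$ denotes the lexicographic product: the graph formed by replacing each vertex of $G$ by a copy of $H$ and inserting all edges between two copies of $H$ if and only if the corresponding vertices of $G$ are adjacent. $K_{1,n-1}$ is the star on $n$ vertices and $K_2$ the complete graph on two vertices. *)

theory Defs
  imports
    "HOL-Complex_Analysis.Complex_Analysis"
    "HOL-Computational_Algebra.Polynomial"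
    "Graph_Theory.Graph_Theory"
begin

text \<open>
  A finite simple graph is a \<^locale>\<open>graph\<close> in the sense of \<open>Graph_Theory\<close>: a finite,
  loop-free, symmetric digraph without parallel arcs, each undirected edge being a pair of
  opposite arcs.

  For such graphs \<^const>\<open>pre_digraph.cycle\<close> also counts going back and forth along one edge
  as a cycle (of length 2). Cycles of the undirected graph are the ones of length at
  least 3; hence \<^const>\<open>forest\<close> of the library cannot be used here.
\<close>

definition acyclic_graph :: "('a, 'b) pre_digraph \<Rightarrow> bool" where
  "acyclic_graph G \<longleftrightarrow> \<not> (\<exists>p. pre_digraph.cycle G p \<and> 3 \<le> length p)"

definition acyclic_coeff :: "('a, 'b) pre_digraph \<Rightarrow> nat \<Rightarrow> nat" where
  "acyclic_coeff G i =
     card {S. S \<subseteq> verts G \<and> card S = i \<and> acyclic_graph (induce_subgraph G S)}"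

text \<open>The sum may stop at the number of vertices, since all later coefficients vanish.\<close>

definition acyclic_poly :: "('a, 'b) pre_digraph \<Rightarrow> 'c::comm_semiring_1 poly" where
  "acyclic_poly G = (\<Sum>i\<le>card (verts G). monom (of_nat (acyclic_coeff G i)) i)"

definition lex_product ::
    "'a pair_pre_digraph \<Rightarrow> 'b pair_pre_digraph \<Rightarrow> ('a \<times> 'b) pair_pre_digraph" where
  "lex_product G H = \<lparr>
     pverts = pverts G \<times> pverts H,
     parcs = {((g, h), (g', h')) | g h g' h'.
       g \<in> pverts G \<and> g' \<in> pverts G \<and> h \<in> pverts H \<and> h' \<in> pverts H \<and>
       ((g, g') \<in> parcs G \<or> g = g' \<and> (h, h') \<in> parcs H)} \<rparr>"

text \<open>The star on \<open>n\<close> vertices, with centre \<open>0\<close>.\<close>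

definition star_graph :: "nat \<Rightarrow> nat pair_pre_digraph" where
  "star_graph n = \<lparr> pverts = {0..<n}, parcs = {0} \<times> {1..<n} \<union> {1..<n} \<times> {0} \<rparr>"

definition complete_graph :: "nat \<Rightarrow> nat pair_pre_digraph" where
  "complete_graph n =
     \<lparr> pverts = {0..<n}, parcs = {(u, v). u \<in> {0..<n} \<and> v \<in> {0..<n} \<and> u \<noteq> v} \<rparr>"

lemma star_graph_is_complete_bipartite:
  assumes "1 \<le> n"
  shows "K\<^bsub>1,n - 1\<^esub> (with_proj (star_graph n))"
  unfolding complete_bipartite_digraph_pair_def
  by (intro conjI exI[of _ "{0}"] exI[of _ "{1..<n}"])
    (use assms in \<open>auto simp: star_graph_def\<close>)

lemma complete_graph_is_complete: "K\<^bsub>n\<^esub> (with_proj (complete_graph n))"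
  unfolding complete_digraph_pair_def by (auto simp: complete_graph_def)

lemma pair_graph_lex_product:
  assumes "pair_graph G" and "pair_graph H"
  shows "pair_graph (lex_product G H)"
proof -
  interpret G: pair_graph G by fact
  interpret H: pair_graph H by fact
  have sub: "parcs (lex_product G H) \<subseteq> (pverts G \<times> pverts H) \<times> (pverts G \<times> pverts H)"
    by (auto simp: lex_product_def)
  have "symmetric (with_proj (lex_product G H))"
    using G.pair_sym_arcs H.pair_sym_arcs
    by (auto simp: symmetric_def sym_def lex_product_def)
  moreover have "finite (parcs (lex_product G H))"
    by (rule finite_subset[OF sub]) (simp add: G.pair_finite_verts H.pair_finite_verts)
  moreover have "finite (pverts (lex_product G H))"
    by (simp add: lex_product_def G.pair_finite_verts H.pair_finite_verts)
  ultimately show ?thesis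
    by unfold_locales (auto simp: lex_product_def dest: G.pair_no_loops H.pair_no_loops)
qed

lemma coeff_acyclic_poly:
  assumes "finite (verts G)"
  shows "coeff (acyclic_poly G) i = of_nat (acyclic_coeff G i)"
proof (cases "i \<le> card (verts G)")
  case True
  then show ?thesis
    by (simp add: acyclic_poly_def coeff_sum coeff_monom)
next
  case False
  then have "{S. S \<subseteq> verts G \<and> card S = i \<and> acyclic_graph (induce_subgraph G S)} = {}"
    using card_mono[OF assms] by auto
  then have "acyclic_coeff G i = 0"
    by (simp only: acyclic_coeff_def card.empty)
  with False show ?thesis
    by (simp add: acyclic_poly_def coeff_sum coeff_monom)
qed

end

theory Submission
  imports Defs
begin

text \<open>
  An acyclic set of vertices of \<open>K\<^sub>1\<^sub>,\<^sub>m[K\<^sub>2]\<close> contains no, one or two vertices of the central copy of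
  \<open>K\<^sub>2\<close>. Central vertices are adjacent to everything outside the central copy, so the only
  obstructions are triangles, and the acyclic polynomial is
  \<open>(1 + z)\<^sup>2\<^sup>m + 2 * z * (1 + 2 * z)\<^sup>m + z\<^sup>2\<close> (lemma \<open>poly_acyclic_star_blowup\<close>).

  For large \<open>m\<close> the roots of such a combination of \<open>m\<close>-th powers accumulate where the two dominant
  bases have equal modulus, here on \<open>\<bar>1 + z\<bar>\<^sup>2 = \<bar>1 + 2 * z\<bar>\<close> (the phenomenon described by Beraha,
  Kahane and Weiss). In polar coordinates this is the limacon \<open>\<rho> = sqrt 2 - 2 * cos \<theta>\<close>, which
  enters the right half-plane; there \<open>\<bar>1 + 2 * z\<bar> > 1\<close>, so that the summand \<open>z\<^sup>2\<close> is negligible.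

  To obtain an actual root, the quotient of the two bases is written as \<open>exp s\<close>, and \<open>s\<close> serves as
  coordinate near a point of the curve with positive real part (lemma \<open>equimodular_branch\<close>).
  Taking logarithms, the equation becomes \<open>m * s = Ln (u s) + \<i> * \<pi> * (2 * k + 1)\<close> with a function
  \<open>u\<close> whose logarithm is continuous and bounded independently of \<open>m\<close>. For a suitable integer
  \<open>k\<close> and large \<open>m\<close>, a solution \<open>s\<close> is a fixed point of a continuous self-map of a small disc,
  and it exists by Brouwer's theorem (lemma \<open>exp_multiple_solution_near_imaginary_axis\<close>).
\<close>

section \<open>Acyclic sets and generating functions\<close>

text \<open>
  Two consecutive vertices of a cycle are distinct, so one of them differs from \<open>c\<close>; its two
  neighbours on the cycle are distinct because the cycle is longer than 2. This one criterion
  covers both kinds of forest met below: matchings, and stars with centre \<open>c\<close>.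
\<close>

lemma acyclic_graph_if_unique_neighbours:
  assumes nbr: "\<And>v a b. v \<noteq> c \<Longrightarrow> (v, a) \<in> parcs G \<Longrightarrow> (v, b) \<in> parcs G \<Longrightarrow>
      v \<in> S \<Longrightarrow> a \<in> S \<Longrightarrow> b \<in> S \<Longrightarrow> a = b"
    and sym: "sym (parcs G)"
  shows "acyclic_graph (induce_subgraph (with_proj G) S)"
  unfolding acyclic_graph_def
proof (rule notI, elim exE conjE)
  let ?H = "induce_subgraph (with_proj G) S"
  interpret H: pre_digraph ?H .
  fix p assume p: "H.cycle p" "3 \<le> length p"
  then obtain e1 e2 e3 es where pe: "p = e1 # e2 # e3 # es"
    by (metis One_nat_def Suc_le_length_iff numeral_3_eq_3)
  from p(1) obtain u where u: "H.awalk u p u" "distinct (tl (H.awalk_verts u p))"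
    unfolding H.cycle_def by blast
  obtain a b d where e: "e1 = (u, a)" "e2 = (a, b)" "e3 = (b, d)" and es: "H.cas d es u"
    and arcs: "set p \<subseteq> arcs ?H"
    using u(1) unfolding H.awalk_def pe by (cases e1; cases e2; cases e3) auto
  have dist: "distinct (a # b # H.awalk_verts d es)"
    using u(2) unfolding pe e by simp
  have "d \<in> set (H.awalk_verts d es) \<and> u \<in> set (H.awalk_verts d es)"
    using es by (induction es arbitrary: d) auto
  then have ne: "a \<noteq> b" "d \<noteq> a" "u \<noteq> b" using dist by auto
  have arcs': "(u, a) \<in> parcs G" "(a, b) \<in> parcs G" "(b, d) \<in> parcs G"
    and S: "u \<in> S" "a \<in> S" "b \<in> S" "d \<in> S"
    using arcs unfolding pe e by auto
  have "(a, u) \<in> parcs G" "(b, a) \<in> parcs G" using arcs' sym by (auto dest: symD)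
  then have "a = c" "b = c" using nbr[of a u b] nbr[of b a d] arcs' S ne by auto
  then show False using ne by simp
qed

lemma triangle_not_acyclic_graph:
  assumes "(u, v) \<in> parcs G" "(v, w) \<in> parcs G" "(w, u) \<in> parcs G"
    and "u \<in> S" "v \<in> S" "w \<in> S" and "u \<noteq> v" "v \<noteq> w" "w \<noteq> u"
  shows "\<not> acyclic_graph (induce_subgraph (with_proj G) S)"
proof -
  let ?H = "induce_subgraph (with_proj G) S"
  interpret H: pre_digraph ?H .
  have "H.cycle [(u, v), (v, w), (w, u)]"
    unfolding H.cycle_def H.awalk_def using assms by (intro exI[of _ u]) auto
  then show ?thesis
    unfolding acyclic_graph_def by (intro notI) (auto intro!: exI[of _ "[(u, v), (v, w), (w, u)]"])
qed

lemma poly_acyclic_poly: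
  assumes "finite (verts G)"
  shows "poly (acyclic_poly G) (z :: 'c :: comm_semiring_1) =
    (\<Sum>S | S \<subseteq> verts G \<and> acyclic_graph (induce_subgraph G S). z ^ card S)"
proof -
  let ?A = "{S. S \<subseteq> verts G \<and> acyclic_graph (induce_subgraph G S)}"
  have fin: "finite ?A" using assms by simp
  have "(\<Sum>S\<in>?A. z ^ card S) =
      (\<Sum>i\<le>card (verts G). \<Sum>S | S \<in> ?A \<and> card S = i. z ^ card S)"
    by (rule sum.group[symmetric, OF fin]) (use assms in \<open>auto intro: card_mono\<close>)
  also have "\<dots> = (\<Sum>i\<le>card (verts G). of_nat (acyclic_coeff G i) * z ^ i)"
    by (intro sum.cong refl)
      (auto simp: acyclic_coeff_def intro!: arg_cong2[of _ _ _ _ "(*)"] arg_cong[of _ _ of_nat]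
        arg_cong[of _ _ card])
  also have "\<dots> = poly (acyclic_poly G) z"
    by (simp add: acyclic_poly_def poly_sum poly_monom)
  finally show ?thesis ..
qed

text \<open>
  A set \<open>S \<subseteq> I \<times> J\<close> is the same as the family of its fibres \<open>S `` {i}\<close>, and its cardinality is
  the sum of theirs. So the generating function by cardinality factors over \<open>I\<close> when the
  fibres are constrained independently of each other.
\<close>

lemma sum_power_card_fibres:
  fixes z :: "'c :: comm_semiring_1"
  assumes "finite I" and "finite J" and F: "\<And>X. X \<in> F \<Longrightarrow> X \<subseteq> J"
  shows "(\<Sum>S | S \<subseteq> I \<times> J \<and> (\<forall>i\<in>I. S `` {i} \<in> F). z ^ card S) = (\<Sum>X\<in>F. z ^ card X) ^ card I"
proof -
  have finF: "finite F" using F \<open>finite J\<close> by (meson finite_Pow_iff finite_subset Pow_iff subsetI)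
  have eq: "{S. S \<subseteq> I \<times> J \<and> (\<forall>i\<in>I. S `` {i} \<in> F)} = Sigma I ` (I \<rightarrow>\<^sub>E F)"
  proof (intro equalityI subsetI)
    fix S assume S: "S \<in> {S. S \<subseteq> I \<times> J \<and> (\<forall>i\<in>I. S `` {i} \<in> F)}"
    then have "S = Sigma I (\<lambda>i\<in>I. S `` {i})" by auto
    moreover have "(\<lambda>i\<in>I. S `` {i}) \<in> I \<rightarrow>\<^sub>E F" using S by auto
    ultimately show "S \<in> Sigma I ` (I \<rightarrow>\<^sub>E F)" by blast
  next
    fix S assume "S \<in> Sigma I ` (I \<rightarrow>\<^sub>E F)"
    then obtain g where g: "g \<in> I \<rightarrow>\<^sub>E F" "S = Sigma I g" by blast
    have "S `` {i} = g i" if "i \<in> I" for i using that g by auto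
    then show "S \<in> {S. S \<subseteq> I \<times> J \<and> (\<forall>i\<in>I. S `` {i} \<in> F)}" using g F by (fastforce dest: PiE_mem)
  qed
  have inj: "inj_on (Sigma I) (I \<rightarrow>\<^sub>E F)"
  proof (rule inj_onI)
    fix g h assume gh: "g \<in> I \<rightarrow>\<^sub>E F" "h \<in> I \<rightarrow>\<^sub>E F" "Sigma I g = Sigma I h"
    have "g i = h i" if "i \<in> I" for i using gh(3) that by blast
    then show "g = h" using gh(1,2) by (rule PiE_ext[rotated 2])
  qed
  have "(\<Sum>S | S \<subseteq> I \<times> J \<and> (\<forall>i\<in>I. S `` {i} \<in> F). z ^ card S) = (\<Sum>g\<in>I \<rightarrow>\<^sub>E F. z ^ card (Sigma I g))"
    unfolding eq by (simp add: sum.reindex[OF inj])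
  also have "\<dots> = (\<Sum>g\<in>I \<rightarrow>\<^sub>E F. \<Prod>i\<in>I. z ^ card (g i))"
  proof (rule sum.cong[OF refl])
    fix g assume "g \<in> I \<rightarrow>\<^sub>E F"
    then have "finite (g i)" if "i \<in> I" for i
      using F that \<open>finite J\<close> by (meson PiE_mem finite_subset)
    then show "z ^ card (Sigma I g) = (\<Prod>i\<in>I. z ^ card (g i))"
      using \<open>finite I\<close> by (simp add: card_SigmaI power_sum)
  qed
  also have "\<dots> = (\<Prod>i\<in>I. \<Sum>X\<in>F. z ^ card X)"
    by (rule prod_sum_PiE[symmetric]) (use \<open>finite I\<close> finF in auto)
  finally show ?thesis by simp
qed

section \<open>The acyclic polynomial of the blown-up star\<close>

abbreviation star_blowup :: "nat \<Rightarrow> (nat \<times> nat) pair_pre_digraph" where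
  "star_blowup n \<equiv> lex_product (star_graph n) (complete_graph 2)"

lemma pverts_star_blowup: "pverts (star_blowup n) = {0..<n} \<times> {0, 1}"
  by (auto simp: lex_product_def star_graph_def complete_graph_def)

lemma parcs_star_blowup:
  "((i, h), (j, k)) \<in> parcs (star_blowup n) \<longleftrightarrow>
     i < n \<and> j < n \<and> h < 2 \<and> k < 2 \<and> ((i = 0) \<noteq> (j = 0) \<or> i = j \<and> h \<noteq> k)"
  by (auto simp: lex_product_def star_graph_def complete_graph_def)

text \<open>
  Two adjacent vertices over the same base vertex \<open>i\<close>, together with any vertex over a base
  vertex adjacent to \<open>i\<close>, form a triangle. Hence a central vertex in \<open>S\<close> forbids full fibres over
  the leaves, and a full central fibre forbids every other vertex. Apart from these triangles
  there is no obstruction: what remains is a matching with isolated vertices, a star, or one edge.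
\<close>

lemma acyclic_star_blowup_iff:
  assumes S: "S \<subseteq> {0..<n} \<times> {0, 1}"
  shows "acyclic_graph (induce_subgraph (with_proj (star_blowup n)) S) \<longleftrightarrow>
    S `` {0} = {} \<or>
    (\<exists>h. S `` {0} = {h} \<and> (\<forall>i\<in>{1..<n}. S `` {i} \<in> {{}, {0}, {1}})) \<or>
    S = {0} \<times> {0, 1}" (is "?L \<longleftrightarrow> ?R")
proof
  assume L: ?L
  have no_triangle: False
    if "(i, h) \<in> S" "(j, k) \<in> S" "(l, q) \<in> S"
      "(i, h) \<noteq> (j, k)" "(j, k) \<noteq> (l, q)" "(l, q) \<noteq> (i, h)"
      "(i = 0) \<noteq> (j = 0) \<or> i = j" "(j = 0) \<noteq> (l = 0) \<or> j = l" "(l = 0) \<noteq> (i = 0) \<or> l = i"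
    for i h j k l q
  proof -
    have "i < n" "j < n" "l < n" "h < 2" "k < 2" "q < 2" using that(1-3) S by auto
    then show False
      using triangle_not_acyclic_graph[of "(i, h)" "(j, k)" "star_blowup n" "(l, q)" S] that L
      unfolding parcs_star_blowup by blast
  qed
  have sub: "S `` {i} \<subseteq> {0, 1}" for i using S by auto
  have two: "S `` {i} \<in> {{}, {0}, {1}}" if "\<not> {0, 1} \<subseteq> S `` {i}" for i
    using sub[of i] that by blast
  consider "S `` {0} = {}" | h where "S `` {0} = {h}" | "S `` {0} = {0, 1}"
    using two[of 0] sub[of 0] by blast
  then show ?R
  proof cases
    case (2 h)
    have "S `` {i} \<in> {{}, {0}, {1}}" if "i \<in> {1..<n}" for i
    proof (rule two, rule notI)
      assume "{0, 1} \<subseteq> S `` {i}"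
      then show False using no_triangle[of 0 h i 0 i 1] 2 that by auto
    qed
    then show ?thesis using 2 by blast
  next
    case 3
    then have centre: "(0, 0) \<in> S" "(0, 1) \<in> S" by blast+
    have "i = 0" if "(i, h) \<in> S" for i h
    proof (rule ccontr)
      assume "i \<noteq> 0"
      then show False by (intro no_triangle[OF centre that]) simp_all
    qed
    then have "S \<subseteq> {0} \<times> {0, 1}" using S by blast
    then have "S = {0} \<times> {0, 1}" using centre by blast
    then show ?thesis by blast
  qed simp
next
  have sym: "sym (parcs (star_blowup n))"
    by (rule symI) (auto simp: parcs_star_blowup)
  assume ?R
  then show ?L
  proof (elim disjE exE conjE)
    assume 1: "S `` {0} = {}"
    have partner: "w = (fst v, 1 - snd v)"
      if "(v, w) \<in> parcs (star_blowup n)" "v \<in> S" "w \<in> S" for v w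
    proof -
      obtain i h j k where vw: "v = (i, h)" "w = (j, k)" by fastforce
      have "i \<noteq> 0" "j \<noteq> 0" using 1 that(2,3) unfolding vw by (metis ImageI empty_iff singletonI)+
      then show ?thesis using that(1) unfolding vw parcs_star_blowup by auto
    qed
    show ?thesis
    proof (rule acyclic_graph_if_unique_neighbours[OF _ sym, where c = "(0, 0)"])
      fix v a b
      assume "(v, a) \<in> parcs (star_blowup n)" "(v, b) \<in> parcs (star_blowup n)"
        "v \<in> S" "a \<in> S" "b \<in> S"
      then show "a = b" using partner[of v a] partner[of v b] by simp
    qed
  next
    fix h assume 2: "S `` {0} = {h}" "\<forall>i\<in>{1..<n}. S `` {i} \<in> {{}, {0}, {1}}"
    have h0: "k = h" if "(0, k) \<in> S" for k using that 2(1) by auto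
    have leaf: "k = q" if "(i, k) \<in> S" "(i, q) \<in> S" "i \<noteq> 0" for i k q
    proof -
      define X where "X = S `` {i}"
      have "i \<in> {1..<n}" using that S by auto
      then have "X \<in> {{}, {0}, {1}}" unfolding X_def by (rule bspec[OF 2(2)])
      moreover have "k \<in> X" "q \<in> X" using that(1,2) by (auto simp: X_def)
      ultimately show ?thesis by auto
    qed
    show ?thesis
    proof (rule acyclic_graph_if_unique_neighbours[OF _ sym, where c = "(0, h)"])
      fix v a b
      assume *: "v \<noteq> (0, h)" "(v, a) \<in> parcs (star_blowup n)" "(v, b) \<in> parcs (star_blowup n)"
        "v \<in> S" "a \<in> S" "b \<in> S"
      obtain i k where v: "v = (i, k)" by fastforce
      have i: "i \<noteq> 0" using *(1,4) h0[of k] unfolding v by (cases "i = 0") auto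
      have "w = (0, h)" if w: "(v, w) \<in> parcs (star_blowup n)" "w \<in> S" for w
      proof -
        obtain j q where wq: "w = (j, q)" by fastforce
        have "j = 0" using w i *(4) leaf[of i k q] unfolding v wq parcs_star_blowup by blast
        then show ?thesis using h0 w wq by blast
      qed
      then show "a = b" using * by blast
    qed
  next
    assume 3: "S = {0} \<times> {0, 1}"
    then show ?thesis
      by (intro acyclic_graph_if_unique_neighbours[OF _ sym, where c = "(0, 0)"])
        (auto simp: parcs_star_blowup)
  qed
qed

text \<open>
  The three summands count the acyclic sets with no, one and two vertices over the centre. In
  the first case each of the \<open>n - 1\<close> leaf fibres is arbitrary and contributes \<open>(1 + z)\<^sup>2\<close>, written
  as \<open>1 + 2 * z + z\<^sup>2\<close>; in the second it has at most one element and contributes \<open>1 + 2 * z\<close>.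
\<close>

lemma poly_acyclic_star_blowup:
  fixes z :: "'c :: comm_ring_1"
  assumes "n \<ge> 1"
  shows "poly (acyclic_poly (with_proj (star_blowup n))) z =
    (1 + 2 * z + z\<^sup>2) ^ (n - 1) + 2 * z * (1 + 2 * z) ^ (n - 1) + z\<^sup>2"
proof -
  define L where "L = {1..<n}"
  define F :: "nat set set" where "F = {{}, {0}, {1}}"
  define A where "A = {S. S \<subseteq> L \<times> {0, 1} \<and> (\<forall>i\<in>L. S `` {i} \<in> Pow {0, 1 :: nat})}"
  define T where "T = {S. S \<subseteq> L \<times> {0, 1} \<and> (\<forall>i\<in>L. S `` {i} \<in> F)}"
  let ?c = "{0} \<times> {0, 1} :: (nat \<times> nat) set"
  have V: "{0..<n} = insert 0 L" "0 \<notin> L" "finite L" "card L = n - 1"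
    using assms by (auto simp: L_def)
  have finA: "finite A" and finT: "finite T"
    unfolding A_def T_def using V(3) by (auto intro: finite_subset[of _ "Pow (L \<times> {0, 1})"])
  \<comment> \<open>\<open>A\<close> holds the acyclic sets avoiding the centre; those with one central vertex are obtained
     from \<open>T\<close> by inserting it.\<close>
  have "{S. S \<subseteq> verts (with_proj (star_blowup n)) \<and>
        acyclic_graph (induce_subgraph (with_proj (star_blowup n)) S)}
      = A \<union> (insert (0, 0) ` T \<union> (insert (0, 1) ` T \<union> {?c}))" (is "?X = _")
  proof (intro equalityI subsetI)
    fix S assume "S \<in> ?X"
    then have S: "S \<subseteq> {0..<n} \<times> {0, 1}"
      and ac: "acyclic_graph (induce_subgraph (with_proj (star_blowup n)) S)"
      by (auto simp: pverts_star_blowup)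
    from ac have "S `` {0} = {} \<or> (\<exists>h. S `` {0} = {h} \<and> (\<forall>i\<in>L. S `` {i} \<in> F)) \<or> S = ?c"
      unfolding acyclic_star_blowup_iff[OF S] L_def F_def .
    then show "S \<in> A \<union> (insert (0, 0) ` T \<union> (insert (0, 1) ` T \<union> {?c}))"
    proof (elim disjE exE conjE)
      assume 1: "S `` {0} = {}"
      then have "S \<in> A" using S unfolding A_def V by auto
      then show ?thesis by blast
    next
      fix h assume 2: "S `` {0} = {h}" "\<forall>i\<in>L. S `` {i} \<in> F"
      have h: "h = 0 \<or> h = 1" "(0, h) \<in> S" using 2(1) S by auto
      have "(S - {(0, h)}) `` {i} = S `` {i}" if "i \<in> L" for i using that V(2) by auto
      moreover have "S - {(0, h)} \<subseteq> L \<times> {0, 1}" using S 2(1) unfolding V(1) by auto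
      ultimately have "S - {(0, h)} \<in> T" using 2(2) by (auto simp: T_def)
      then have "S \<in> insert (0, h) ` T" using h(2) by (intro image_eqI[of _ _ "S - {(0, h)}"]) auto
      then show ?thesis using h(1) by blast
    qed blast
  next
    fix S assume "S \<in> A \<union> (insert (0, 0) ` T \<union> (insert (0, 1) ` T \<union> {?c}))"
    then consider "S \<in> A" | h R where "S = insert (0, h) R" "R \<in> T" "h = 0 \<or> h = 1" | "S = ?c"
      unfolding Un_iff image_iff singleton_iff by metis
    then have "S \<subseteq> {0..<n} \<times> {0, 1} \<and> (S `` {0} = {} \<or>
        (\<exists>h. S `` {0} = {h} \<and> (\<forall>i\<in>{1..<n}. S `` {i} \<in> {{}, {0}, {1}})) \<or> S = ?c)"
    proof cases
      case 1
      then show ?thesis unfolding A_def V(1) using V(2) by auto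
    next
      case (2 h R)
      have "S `` {i} = R `` {i}" if "i \<in> L" for i using that V(2) 2(1) by auto
      moreover have "S `` {0} = {h}" using 2 V(2) unfolding T_def by auto
      moreover have "S \<subseteq> {0..<n} \<times> {0, 1}" using 2 unfolding V(1) T_def by auto
      ultimately show ?thesis using 2(2) unfolding T_def L_def F_def by auto
    qed (use V(1) in auto)
    then show "S \<in> ?X" using acyclic_star_blowup_iff[of S n]
      by (auto simp: pverts_star_blowup simp del: One_nat_def)
  qed
  moreover have zero: "(0, h) \<notin> S" if "S \<in> A \<union> T" for S h
    using that V(2) unfolding A_def T_def by auto
  moreover have sum_insert: "(\<Sum>S\<in>insert (0, h) ` T. z ^ card S) = z * (\<Sum>S\<in>T. z ^ card S)" for h
  proof -
    have "inj_on (insert (0, h)) T" using zero by (intro inj_onI) (metis Diff_insert_absorb UnI2)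
    moreover have "card (insert (0, h) S) = Suc (card S)" if "S \<in> T" for S
    proof (rule card_insert_disjoint)
      have "S \<subseteq> L \<times> {0, 1}" using that by (simp add: T_def)
      then show "finite S" by (rule finite_subset) (simp add: V(3))
      show "(0, h) \<notin> S" using zero that by blast
    qed
    ultimately show ?thesis by (simp add: sum.reindex sum_distrib_left)
  qed
  moreover have "A \<inter> (insert (0, 0) ` T \<union> (insert (0, 1) ` T \<union> {?c})) = {}"
    using zero by blast
  moreover have "insert (0, 0) ` T \<inter> (insert (0, 1) ` T \<union> {?c}) = {}"
  proof -
    have "(0, 1) \<notin> S" if "S \<in> insert (0, 0) ` T" for S using that zero by auto
    moreover have "(0, 1) \<in> S" if "S \<in> insert (0, 1) ` T \<union> {?c}" for S using that by auto
    ultimately show ?thesis by (meson disjoint_iff)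
  qed
  moreover have "insert (0, 1) ` T \<inter> {?c} = {}"
  proof -
    have "(0, 0) \<notin> S" if "S \<in> insert (0, 1) ` T" for S using that zero by auto
    then show ?thesis by blast
  qed
  ultimately have "poly (acyclic_poly (with_proj (star_blowup n))) z =
      (\<Sum>S\<in>A. z ^ card S) + (z * (\<Sum>S\<in>T. z ^ card S) + (z * (\<Sum>S\<in>T. z ^ card S) + z ^ card ?c))"
    using finA finT
    by (subst poly_acyclic_poly)
      (simp_all add: pverts_star_blowup sum.union_disjoint del: insert_Times_insert)
  also have "(\<Sum>S\<in>A. z ^ card S) = (\<Sum>X\<in>Pow {0, 1::nat}. z ^ card X) ^ (n - 1)"
    unfolding A_def by (subst sum_power_card_fibres) (use V in auto)
  also have "(\<Sum>X\<in>Pow {0, 1::nat}. z ^ card X) = 1 + 2 * z + z\<^sup>2"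
    by (simp add: Pow_insert insert_eq_iff power2_eq_square)
  also have "(\<Sum>S\<in>T. z ^ card S) = (\<Sum>X\<in>F. z ^ card X) ^ (n - 1)"
    unfolding T_def by (subst sum_power_card_fibres) (use V in \<open>auto simp: F_def\<close>)
  also have "(\<Sum>X\<in>F. z ^ card X) = 1 + 2 * z" by (simp add: F_def)
  finally show ?thesis by (simp add: card_cartesian_product power2_eq_square algebra_simps)
qed

section \<open>A root near the equimodular curve\<close>

text \<open>
  The equation says \<open>m * s = g s + \<i> * c\<close> for some odd multiple \<open>c\<close> of \<open>\<pi>\<close>. With \<open>c\<close> chosen as
  near as possible to \<open>m * Im a\<close>, the map \<open>s \<mapsto> (g s + \<i> * c) / m\<close> moves every point of the disc
  to within \<open>(B + \<pi>) / m\<close> of \<open>a\<close>, so it is a self-map of the disc and Brouwer's theorem applies.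
  The centre must be purely imaginary because the real part of \<open>(g s + \<i> * c) / m\<close> tends to 0
  as \<open>m\<close> grows.
\<close>

lemma exp_multiple_solution_near_imaginary_axis:
  fixes g :: "complex \<Rightarrow> complex" and a :: complex
  assumes cont: "continuous_on (cball a r) g"
    and bound: "\<And>s. s \<in> cball a r \<Longrightarrow> norm (g s) \<le> B"
    and "Re a = 0" and "r > 0" and large: "B + pi \<le> of_nat m * r" and "m > 0"
  obtains s where "s \<in> cball a r" and "exp (of_nat m * s) = - exp (g s)"
proof -
  define k where "k = \<lfloor>real m * Im a / (2 * pi)\<rfloor>"
  define c where "c = pi * (2 * of_int k + 1)"
  have "of_int k \<le> real m * Im a / (2 * pi)" "real m * Im a / (2 * pi) < of_int k + 1"
    unfolding k_def by linarith+
  then have "of_int k * (2 * pi) \<le> real m * Im a" "real m * Im a < (of_int k + 1) * (2 * pi)"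
    by (simp_all add: pos_le_divide_eq pos_divide_less_eq)
  then have near: "\<bar>c - real m * Im a\<bar> \<le> pi"
    unfolding c_def by (simp add: algebra_simps abs_le_iff)
  have a: "of_nat m * a = \<i> * of_real (real m * Im a)"
    using \<open>Re a = 0\<close> by (simp add: complex_eq_iff)
  define T where "T s = (g s + \<i> * of_real c) / of_nat m" for s
  have "T s \<in> cball a r" if "s \<in> cball a r" for s
  proof -
    have "T s - a = (g s + \<i> * of_real c - of_nat m * a) / of_nat m"
      unfolding T_def using \<open>m > 0\<close> by (simp add: field_simps)
    then have "T s - a = (g s + \<i> * of_real (c - real m * Im a)) / of_nat m"
      unfolding a by (simp add: algebra_simps)
    moreover have "norm (g s + \<i> * of_real (c - real m * Im a)) \<le> B + pi"
      by (rule norm_triangle_le, rule add_mono[OF bound[OF that]])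
        (use near in \<open>simp add: norm_mult del: of_real_diff of_real_mult\<close>)
    ultimately have "norm (T s - a) \<le> (B + pi) / real m"
      using \<open>m > 0\<close> by (simp add: norm_divide divide_right_mono)
    also have "\<dots> \<le> r"
      using large \<open>m > 0\<close> by (simp add: field_simps)
    finally show ?thesis
      by (simp add: dist_norm norm_minus_commute)
  qed
  moreover have "continuous_on (cball a r) T"
    unfolding T_def using \<open>m > 0\<close> by (intro continuous_intros cont) auto
  ultimately obtain s where s: "s \<in> cball a r" "T s = s"
    using brouwer_ball[OF \<open>r > 0\<close>, of a T] by blast
  have "of_nat m * s = g s + \<i> * of_real c"
    using s(2) \<open>m > 0\<close> by (simp add: T_def field_simps)
  moreover have "exp (\<i> * of_real c) = -1"
  proof -
    have "\<i> * of_real c = \<i> * (2 * of_int k * pi) + \<i> * pi"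
      by (simp add: c_def algebra_simps)
    then show ?thesis
      by (simp only: exp_add exp_pi_i') (use exp_integer_2pi[of "of_int k"] in \<open>simp add: mult_ac\<close>)
  qed
  ultimately have "exp (of_nat m * s) = - exp (g s)"
    by (simp only: exp_add) simp
  with s(1) show thesis by (rule that)
qed

text \<open>
  The map \<open>t \<mapsto> t / (1 - t)\<close> is the inverse of \<open>x \<mapsto> x / (1 + x)\<close>, which sends the right half-plane
  to the disc with diameter \<open>[0, 1]\<close>; the hypothesis describes this disc.
\<close>

lemma Re_moebius_pos:
  fixes t :: complex
  assumes "(norm t)\<^sup>2 < Re t"
  shows "Re (t / (1 - t)) > 0"
proof -
  have n: "(norm t)\<^sup>2 = (Re t)\<^sup>2 + (Im t)\<^sup>2" by (rule cmod_power2)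
  then have "t \<noteq> 1" using assms by auto
  then have "Re t \<noteq> 1 \<or> Im t \<noteq> 0" by (simp add: complex_eq_iff)
  then have p: "(1 - Re t)\<^sup>2 + (Im t)\<^sup>2 > 0" by (auto simp: sum_power2_gt_zero_iff)
  have "Re (t / (1 - t)) = (Re t - (norm t)\<^sup>2) / ((1 - Re t)\<^sup>2 + (Im t)\<^sup>2)"
    unfolding n by (simp add: Re_divide power2_eq_square algebra_simps)
  then show ?thesis using p assms by simp
qed

text \<open>
  On the curve \<open>\<bar>1 + x\<bar>\<^sup>2 = \<bar>1 + 2 * x\<bar>\<close>, a limacon, the quotient \<open>(1 + x)\<^sup>2 / (1 + 2 * x)\<close>
  is \<open>exp s\<close> with \<open>s\<close> purely imaginary. The substitution \<open>t = x / (1 + x)\<close> turns this quotient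
  into \<open>1 / (1 - t\<^sup>2)\<close>, so \<open>t = csqrt (1 - exp (- s))\<close> solves for \<open>x\<close> explicitly and makes \<open>s\<close> a
  coordinate around the curve. The curve enters the right half-plane, and \<open>a\<close> is the coordinate of such a point.
\<close>

lemma equimodular_branch:
  obtains a :: complex and r d :: real and x :: "complex \<Rightarrow> complex" and K :: real
  where "Re a = 0" and "r > 0" and "d > 0" and "continuous_on (cball a r) x"
    and "\<And>s. s \<in> cball a r \<Longrightarrow> d \<le> Re (x s) \<and> norm (x s) \<le> K"
    and "\<And>s. (1 + x s)\<^sup>2 = exp s * (1 + 2 * x s)"
proof -
  \<comment> \<open>The unit vector \<open>(12 - 5 * \<i>) / 13\<close> is a rational choice of \<open>exp (- a)\<close>. With it
     \<open>(norm (t a))\<^sup>2 = sqrt (2 / 13)\<close>, which is about 0.39, while \<open>Re (t a)\<close> is about 0.48.\<close>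
  define a where "a = - Ln (Complex (12/13) (-5/13))"
  define t where "t s = csqrt (1 - exp (- s))" for s
  define x where "x s = t s / (1 - t s)" for s
  have t2: "(t s)\<^sup>2 = 1 - exp (- s)" for s by (simp add: t_def)
  have t1: "t s \<noteq> 1" "t s \<noteq> -1" for s
    using t2[of s] by auto
  have branch: "(1 + x s)\<^sup>2 = exp s * (1 + 2 * x s)" for s
  proof -
    have "1 - t s \<noteq> 0" using t1[of s] by simp
    then have e: "1 + x s = 1 / (1 - t s)" "1 + 2 * x s = (1 + t s) / (1 - t s)"
      by (simp_all add: x_def field_simps)
    have "exp s * ((1 + t s) * (1 - t s)) = exp s * (1 - (t s)\<^sup>2)"
      by (simp add: algebra_simps power2_eq_square)
    also have "\<dots> = 1" by (simp add: t2 exp_minus)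
    finally have "(1 / (1 - t s))\<^sup>2 = exp s * ((1 + t s) * (1 - t s)) / (1 - t s)\<^sup>2"
      by (simp add: power_divide)
    also have "\<dots> = exp s * ((1 + t s) / (1 - t s))"
      using \<open>1 - t s \<noteq> 0\<close> by (simp add: power2_eq_square)
    finally show ?thesis unfolding e .
  qed
  have cn: "Complex (12/13) (-5/13) \<noteq> 0" by (simp add: complex_eq_iff)
  then have ea: "exp (- a) = Complex (12/13) (-5/13)" by (simp add: a_def)
  have "norm (Complex (12/13) (-5/13)) = 1" by (simp add: cmod_def power2_eq_square)
  then have "Re a = 0" using cn by (simp add: a_def Re_Ln)
  have v: "1 - exp (- a) = Complex (1/13) (5/13)" by (simp add: ea complex_eq_iff)
  define q where "q = norm (Complex (1/13) (5/13))"
  have q2: "q\<^sup>2 = 2/13" by (simp add: q_def cmod_power2) (simp add: power2_eq_square)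
  have q3: "q > 3/13"
    by (rule power2_less_imp_less[of _ q]) (simp_all add: q2, simp_all add: power2_eq_square q_def)
  have "Re (t a) = sqrt ((q + 1/13) / 2)" by (simp add: t_def v q_def)
  moreover have "q < sqrt ((q + 1/13) / 2)"
    by (rule real_less_rsqrt) (use q2 q3 in simp)
  moreover have "(norm (t a))\<^sup>2 = q" by (simp add: t_def v q_def)
  ultimately have "Re (x a) > 0" unfolding x_def by (intro Re_moebius_pos) simp
  define d where "d = Re (x a) / 2"
  have "d > 0" using \<open>Re (x a) > 0\<close> by (simp add: d_def)
  \<comment> \<open>Continuity keeps \<open>x s\<close> close to \<open>x a\<close> on a small disc that avoids the branch cut of \<open>csqrt\<close>.\<close>
  define W where "W = {s::complex. 1 - exp (- s) \<notin> \<real>\<^sub>\<le>\<^sub>0}"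
  have W: "W = (\<lambda>s. 1 - exp (- s)) -` (- \<real>\<^sub>\<le>\<^sub>0)" by (auto simp: W_def)
  have "open W"
    unfolding W by (rule open_vimage) (auto intro!: continuous_intros simp: closed_nonpos_Reals_complex)
  have "a \<in> W" unfolding W_def mem_Collect_eq v by (simp add: complex_nonpos_Reals_iff)
  have cx: "continuous_on W x"
    unfolding x_def t_def
    by (intro continuous_intros continuous_on_compose2[OF continuous_on_csqrt])
      (use t1 in \<open>auto simp: W_def t_def\<close>)
  have "open (W \<inter> x -` ball (x a) d)"
    using continuous_open_preimage[OF cx \<open>open W\<close> open_ball] .
  moreover have "a \<in> W \<inter> x -` ball (x a) d" using \<open>a \<in> W\<close> \<open>d > 0\<close> by simp
  ultimately obtain r where r: "r > 0" "cball a r \<subseteq> W \<inter> x -` ball (x a) d"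
    by (meson open_contains_cball)
  show thesis
  proof (rule that[OF \<open>Re a = 0\<close> r(1) \<open>d > 0\<close> _ _ branch])
    show "continuous_on (cball a r) x" using cx r(2) by (meson continuous_on_subset le_inf_iff)
    show "d \<le> Re (x s) \<and> norm (x s) \<le> norm (x a) + d" if "s \<in> cball a r" for s
    proof -
      have n: "norm (x s - x a) < d" using that r(2) by (auto simp: dist_norm norm_minus_commute)
      have "\<bar>Re (x s - x a)\<bar> < d" using n abs_Re_le_cmod[of "x s - x a"] by linarith
      moreover have "norm (x s) \<le> norm (x a) + norm (x s - x a)"
        by (metis add.commute diff_add_cancel norm_triangle_ineq)
      ultimately show ?thesis
        using n d_def unfolding minus_complex.sel by (intro conjI) linarith+
    qed
  qed
qed

text \<open>
  On the branch \<open>(1 + x)\<^sup>2 = exp s * (1 + 2 * x)\<close>, division by \<open>(1 + 2 * x) ^ m\<close> turns the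
  equation into \<open>exp (m * s) = - u s\<close> with \<open>u s = 2 * x + x\<^sup>2 / (1 + 2 * x) ^ m\<close>. Since \<open>Re x \<ge> d > 0\<close>, the
  last summand tends to 0 uniformly, so \<open>u\<close> stays in a compact part of the right half-plane and
  \<open>Ln (u s)\<close> is continuous and bounded independently of \<open>m\<close>.
\<close>

lemma eventually_root_right_half_plane:
  "\<exists>M. \<forall>m\<ge>M. \<exists>z::complex.
     (1 + 2 * z + z\<^sup>2) ^ m + 2 * z * (1 + 2 * z) ^ m + z\<^sup>2 = 0 \<and> Re z > 0"
proof -
  obtain a r d and x :: "complex \<Rightarrow> complex" and K
    where "Re a = 0" "r > 0" "d > 0" and cx: "continuous_on (cball a r) x"
      and bd: "\<And>s. s \<in> cball a r \<Longrightarrow> d \<le> Re (x s) \<and> norm (x s) \<le> K"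
      and branch: "\<And>s. (1 + x s)\<^sup>2 = exp s * (1 + 2 * x s)"
    by (rule equimodular_branch) blast
  define B where "B = \<bar>ln d\<bar> + \<bar>ln (2 * K + d)\<bar> + pi"
  have "(\<lambda>m. K\<^sup>2 * inverse (1 + 2 * d) ^ m) \<longlonglongrightarrow> K\<^sup>2 * 0"
    using \<open>d > 0\<close> by (intro tendsto_intros LIMSEQ_power_zero) (simp add: field_simps)
  then have "\<forall>\<^sub>F m in sequentially. K\<^sup>2 * inverse (1 + 2 * d) ^ m < d"
    using \<open>d > 0\<close> by (intro order_tendstoD(2)) simp
  moreover have "\<forall>\<^sub>F m in sequentially. (B + pi) / r \<le> real m"
    using filterlim_real_sequentially unfolding filterlim_at_top by blast
  moreover have "\<forall>\<^sub>F m in sequentially. m > (0::nat)"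
    by (rule eventually_gt_at_top)
  ultimately have "\<forall>\<^sub>F m in sequentially. \<exists>z::complex.
     (1 + 2 * z + z\<^sup>2) ^ m + 2 * z * (1 + 2 * z) ^ m + z\<^sup>2 = 0 \<and> Re z > 0"
  proof eventually_elim
    case (elim m)
    define u where "u s = 2 * x s + (x s)\<^sup>2 / (1 + 2 * x s) ^ m" for s
    have nz: "1 + 2 * x s \<noteq> 0" if "s \<in> cball a r" for s
      using bd[OF that] \<open>d > 0\<close> by (auto simp: complex_eq_iff)
    \<comment> \<open>The first summand of \<open>u\<close> has real part at least \<open>2 * d\<close>; \<open>m\<close> is so large that the
       second one has norm below \<open>d\<close>.\<close>
    have u: "Re (u s) \<ge> d \<and> norm (u s) \<le> 2 * K + d" if "s \<in> cball a r" for s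
    proof -
      have "1 + 2 * d \<le> Re (1 + 2 * x s)" using bd[OF that] by simp
      also have "\<dots> \<le> norm (1 + 2 * x s)" by (rule complex_Re_le_cmod)
      finally have denominator: "(1 + 2 * d) ^ m \<le> norm (1 + 2 * x s) ^ m"
        using \<open>d > 0\<close> by (intro power_mono) auto
      then have "norm ((x s)\<^sup>2 / (1 + 2 * x s) ^ m) \<le> K\<^sup>2 / (1 + 2 * d) ^ m"
        unfolding norm_divide norm_power using bd[OF that] \<open>d > 0\<close>
        by (intro frac_le denominator power_mono) auto
      also have "\<dots> = K\<^sup>2 * inverse (1 + 2 * d) ^ m"
        by (simp add: power_inverse divide_inverse)
      also have "\<dots> < d" by fact
      finally have e: "norm ((x s)\<^sup>2 / (1 + 2 * x s) ^ m) < d" .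
      have "\<bar>Re ((x s)\<^sup>2 / (1 + 2 * x s) ^ m)\<bar> < d"
        using e abs_Re_le_cmod[of "(x s)\<^sup>2 / (1 + 2 * x s) ^ m"] by linarith
      moreover have "norm (u s) \<le> norm (2 * x s) + norm ((x s)\<^sup>2 / (1 + 2 * x s) ^ m)"
        unfolding u_def by (rule norm_triangle_ineq)
      moreover have "Re (u s) = 2 * Re (x s) + Re ((x s)\<^sup>2 / (1 + 2 * x s) ^ m)"
        by (simp add: u_def)
      ultimately show ?thesis
        using e conjunct1[OF bd[OF that]] conjunct2[OF bd[OF that]]
        unfolding norm_mult norm_numeral by (intro conjI) linarith+
    qed
    have u_pos: "Re (u s) > 0" if "s \<in> cball a r" for s
      using u[OF that] \<open>d > 0\<close> by linarith
    have "norm (Ln (u s)) \<le> B" if "s \<in> cball a r" for s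
    proof -
      have "u s \<noteq> 0" using u_pos[OF that] by auto
      have "d \<le> norm (u s)" using u[OF that] complex_Re_le_cmod[of "u s"] by linarith
      moreover have "norm (u s) > 0" using \<open>u s \<noteq> 0\<close> by simp
      moreover have "2 * K + d > 0" using calculation u[OF that] by linarith
      ultimately have "ln d \<le> ln (norm (u s))" "ln (norm (u s)) \<le> ln (2 * K + d)"
        using u[OF that] \<open>d > 0\<close> by auto
      then have "\<bar>Re (Ln (u s))\<bar> \<le> \<bar>ln d\<bar> + \<bar>ln (2 * K + d)\<bar>"
        using \<open>u s \<noteq> 0\<close> by (simp add: Re_Ln)
      moreover have "\<bar>Im (Ln (u s))\<bar> \<le> pi"
        using mpi_less_Im_Ln[of "u s"] Im_Ln_le_pi[of "u s"] \<open>u s \<noteq> 0\<close> by auto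
      ultimately show ?thesis
        using cmod_le[of "Ln (u s)"] unfolding B_def by linarith
    qed
    moreover have "continuous_on (cball a r) (\<lambda>s. Ln (u s))"
    proof (rule continuous_on_Ln')
      show "continuous_on (cball a r) u"
        unfolding u_def using nz by (intro continuous_intros cx) auto
      show "\<And>s. s \<in> cball a r \<Longrightarrow> u s \<notin> \<real>\<^sub>\<le>\<^sub>0"
        using u_pos by (fastforce simp: complex_nonpos_Reals_iff)
    qed
    moreover have "B + pi \<le> real m * r"
      using elim(2) \<open>r > 0\<close> by (simp add: field_simps)
    ultimately obtain s where s: "s \<in> cball a r" "exp (of_nat m * s) = - exp (Ln (u s))"
      using exp_multiple_solution_near_imaginary_axis[of a r "\<lambda>s. Ln (u s)" B m]
        \<open>Re a = 0\<close> \<open>r > 0\<close> \<open>m > 0\<close>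
      by blast
    have "u s \<noteq> 0" using u_pos[OF s(1)] by auto
    then have es: "exp s ^ m = - u s"
      using s(2) by (simp add: exp_of_nat_mult)
    have "(1 + 2 * x s + (x s)\<^sup>2) ^ m = ((1 + x s)\<^sup>2) ^ m"
      by (simp add: power2_eq_square algebra_simps)
    also have "\<dots> = - u s * (1 + 2 * x s) ^ m"
      unfolding branch power_mult_distrib es ..
    also have "\<dots> = - 2 * x s * (1 + 2 * x s) ^ m - (x s)\<^sup>2"
      using nz[OF s(1)] by (simp add: u_def field_simps)
    finally have "(1 + 2 * x s + (x s)\<^sup>2) ^ m + 2 * x s * (1 + 2 * x s) ^ m + (x s)\<^sup>2 = 0"
      by simp
    moreover have "Re (x s) > 0" using bd[OF s(1)] \<open>d > 0\<close> by linarith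
    ultimately show ?case by blast
  qed
  then show ?thesis by (simp add: eventually_sequentially)
qed

section \<open>Roots with positive real part\<close>

theorem theorem2p24:
  shows "\<exists>N. \<forall>n\<ge>N. \<exists>z::complex.
    poly (acyclic_poly (with_proj (lex_product (star_graph n) (complete_graph 2)))) z = 0 \<and> Re z > 0"
proof -
  obtain M where M: "\<And>m. m \<ge> M \<Longrightarrow> \<exists>z::complex.
      (1 + 2 * z + z\<^sup>2) ^ m + 2 * z * (1 + 2 * z) ^ m + z\<^sup>2 = 0 \<and> Re z > 0"
    using eventually_root_right_half_plane by blast
  show ?thesis
  proof (intro exI[of _ "Suc M"] allI impI)
    fix n assume "n \<ge> Suc M"
    then have "n \<ge> 1" "n - 1 \<ge> M" by auto
    with M[of "n - 1"]
    show "\<exists>z::complex. poly (acyclic_poly (with_proj (star_blowup n))) z = 0 \<and> Re z > 0"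
      by (simp add: poly_acyclic_star_blowup)
  qed
qed

end
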